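(* Let $V$ be an inner product space over $\mathbb{R}$ or $\mathbb{C}$, let $n\ge 1$, and let $\mathbf{y}_1,\dots,\mathbf{y}_n\in V$ be linearly independent. Let $\mathbf{c}_1,\dots,\mathbf{c}_n$ and the scalars $\alpha_1,\dots,\alpha_{n-1}$ be the vectors and scalars obtained from $\mathbf{y}_1,\dots,\mathbf{y}_n$ by the descending recursion given in the context. Put $\beta_i=\sum_{j=1}^{i}\alpha_j$ for $i=1,\dots,n-1$, and $$\mathbf{z}_1=\sum_{i=1}^{n}\mathbf{c}_i,\qquad \mathbf{p}_1=\sum_{i=1}^{n-1}\beta_i\,\mathbf{c}_{i+1},\qquad \gamma=\frac{\langle \mathbf{p}_1,\mathbf{z}_1\rangle}{\langle \mathbf{z}_1,\mathbf{z}_1\rangle},\qquad \mathbf{z}_2=\mathbf{p}_1-\gamma\,\mathbf{z}_1 .$$ Define $\mathbf{d}_i=(1+\gamma)\mathbf{c}_i$ for $i=1,\dots,n$ and $\mathbf{d}_{n+1}=\mathbf{z}_2$. Then $$\sum_{i=1}^{n}\mathbf{y}_i=\sum_{i=1}^{n+1}\mathbf{d}_i$$ and $$\left\lVert \sum_{i=1}^{n}\mathbf{y}_i\right\rVert^2=\left\lVert \sum_{i=1}^{n+1}\mathbf{d}_i\right\rVert^2=\sum_{i=1}^{n+1}\lVert \mathbf{d}_i\rVert^2 .$$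
   Context: The inner product $\langle\cdot,\cdot\rangle$ is linear in its first argument (and conjugate-linear in the second in the complex case), and $\lVert \mathbf{v}\rVert^2=\langle \mathbf{v},\mathbf{v}\rangle$. Empty sums are $0$. Recursion: given linearly independent $\mathbf{y}_1,\dots,\mathbf{y}_n$, set $\mathbf{c}_n=\mathbf{y}_n$ and, for $k=n-1,\dots,2,1$, $$\alpha_k=\frac{\left\langle \mathbf{y}_k,\sum_{i=k+1}^{n}\mathbf{c}_i\right\rangle}{\left\langle \sum_{i=k+1}^{n}\mathbf{c}_i,\sum_{i=k+1}^{n}\mathbf{c}_i\right\rangle},\qquad \mathbf{c}_k=\mathbf{y}_k-\alpha_k\sum_{i=k+1}^{n}\mathbf{c}_i .$$ The denominators here, and $\langle \mathbf{z}_1,\mathbf{z}_1\rangle$ in the definition of $\gamma$, are nonzero because $\mathbf{y}_1,\dots,\mathbf{y}_n$ are linearly independent. *)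

theory Defs
  imports "HOL-Analysis.Inner_Product"
begin

text \<open>
  The distribution has real inner product spaces (class \<^class>\<open>real_inner\<close>) but no complex
  ones.  The inner product is linear in its \<^emph>\<open>first\<close> argument; that
  \<open>cip x x\<close> is real follows from conjugate symmetry.
\<close>

locale complex_inner_space = vector_space scale
  for scale :: "complex \<Rightarrow> 'v::ab_group_add \<Rightarrow> 'v" +
  fixes cip :: "'v \<Rightarrow> 'v \<Rightarrow> complex"
  assumes cip_add_left: "cip (x + y) z = cip x z + cip y z"
    and cip_scale_left: "cip (scale a x) y = a * cip x y"
    and cip_commute: "cip x y = cnj (cip y x)"
    and cip_self_nonneg: "0 \<le> Re (cip x x)"
    and cip_self_eq_0: "cip x x = 0 \<Longrightarrow> x = 0"

definition ip_norm :: "('v \<Rightarrow> 'v \<Rightarrow> complex) \<Rightarrow> 'v \<Rightarrow> real"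
  where "ip_norm cip v = sqrt (Re (cip v v))"

definition lin_indep_family ::
    "('k::field \<Rightarrow> 'v::ab_group_add \<Rightarrow> 'v) \<Rightarrow> (nat \<Rightarrow> 'v) \<Rightarrow> nat \<Rightarrow> bool"
  where "lin_indep_family scale y n \<longleftrightarrow>
    inj_on y {1..n} \<and> \<not> module.dependent scale (y ` {1..n})"

text \<open>
  The construction uses only the scalar multiplication and the inner product, so it is
  defined once for both scalar fields.  Vectors are indexed by \<open>1, \<dots>, n\<close>; values at other
  indices are irrelevant.
\<close>

context
  fixes scale :: "'k::field \<Rightarrow> 'v::ab_group_add \<Rightarrow> 'v"
    and ip :: "'v \<Rightarrow> 'v \<Rightarrow> 'k"
    and y :: "nat \<Rightarrow> 'v"
    and n :: nat
begin

function c_vec :: "nat \<Rightarrow> 'v" where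
  "c_vec k =
    (if k < n then
       y k - scale (ip (y k) (\<Sum>i=k+1..n. c_vec i) /
                    ip (\<Sum>i=k+1..n. c_vec i) (\<Sum>i=k+1..n. c_vec i))
               (\<Sum>i=k+1..n. c_vec i)
     else y k)"
  by auto
termination by (relation "measure (\<lambda>k. n - k)") auto

declare c_vec.simps [simp del]

definition alpha :: "nat \<Rightarrow> 'k" where
  "alpha k = ip (y k) (\<Sum>i=k+1..n. c_vec i) /
             ip (\<Sum>i=k+1..n. c_vec i) (\<Sum>i=k+1..n. c_vec i)"

definition beta :: "nat \<Rightarrow> 'k" where
  "beta i = (\<Sum>j=1..i. alpha j)"

definition z1 :: 'v where
  "z1 = (\<Sum>i=1..n. c_vec i)"

definition p1 :: 'v where
  "p1 = (\<Sum>i=1..n-1. scale (beta i) (c_vec (i + 1)))"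

definition gamma :: 'k where
  "gamma = ip p1 z1 / ip z1 z1"

definition z2 :: 'v where
  "z2 = p1 - scale gamma z1"

definition d_vec :: "nat \<Rightarrow> 'v" where
  "d_vec i = (if i \<le> n then scale (1 + gamma) (c_vec i) else z2)"

lemma c_vec_last: "c_vec n = y n"
  by (subst c_vec.simps) simp

lemma c_vec_step: "k < n \<Longrightarrow> c_vec k = y k - scale (alpha k) (\<Sum>i=k+1..n. c_vec i)"
  unfolding alpha_def by (subst c_vec.simps) simp

end

end

theory Submission
  imports Defs
begin

text \<open>
  Write \<open>S k\<close> for the tail sum of \<open>c i\<close> over \<open>k \<le> i \<le> n\<close>, so that \<open>z1 = S 1\<close>.  The recursion makes
  \<open>c k\<close> the component of \<open>y k\<close> orthogonal to \<open>S (k + 1)\<close>.  The vectors \<open>c i\<close> are in general not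
  pairwise orthogonal, but Pythagoras can still be applied along the splittings
  \<open>S k = c k + S (k + 1)\<close>, and this gives \<open>\<parallel>S 1\<parallel>\<^sup>2 = \<Sum> \<parallel>c i\<parallel>\<^sup>2\<close> (\<open>pythagoras_tails\<close>); a common factor
  \<open>1 + gamma\<close> does not disturb the argument.

  Summing \<open>y k = c k + alpha k S (k + 1)\<close> over \<open>k\<close> and exchanging the order of summation, each
  \<open>c i\<close> collects the coefficient \<open>alpha 1 + \<dots> + alpha (i - 1) = beta (i - 1)\<close>, hence
  \<open>\<Sum> y k = z1 + p1\<close> (\<open>sum_y_eq\<close>).  Splitting \<open>p1\<close> into \<open>gamma z1\<close> and the component \<open>z2\<close>
  orthogonal to \<open>z1\<close> gives \<open>\<Sum> y k = (1 + gamma) z1 + z2 = \<Sum> d i\<close>.  One more use of Pythagoras,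
  for the orthogonal vectors \<open>(1 + gamma) z1\<close> and \<open>z2\<close>, yields the formula for the norms.

  Both scalar fields are treated at once, by means of a form of which only additivity, homogeneity
  in the first argument, symmetry of orthogonality and definiteness are required.
\<close>

text \<open>
  Real inner products and complex ones differ in the scaling rule for the second argument.
  All that Pythagoras needs there is that orthogonality survives scaling, and this follows from
  homogeneity on the left together with the symmetry of orthogonality.
\<close>

locale orthogonality_form = vector_space scale
  for scale :: "'k::field \<Rightarrow> 'v::ab_group_add \<Rightarrow> 'v" +
  fixes ip :: "'v \<Rightarrow> 'v \<Rightarrow> 'k"
  assumes add_left: "ip (u + v) x = ip u x + ip v x"
    and add_right: "ip x (u + v) = ip x u + ip x v"
    and scale_left_form: "ip (scale a u) v = a * ip u v"
    and orth_sym: "ip u v = 0 \<Longrightarrow> ip v u = 0"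
    and definite: "ip u u = 0 \<Longrightarrow> u = 0"
begin

lemma zero_left: "ip 0 v = 0"
  using scale_left_form[of 0 0 v] by simp

lemma zero_right: "ip v 0 = 0"
  by (rule orth_sym) (rule zero_left)

lemma diff_left: "ip (u - v) x = ip u x - ip v x"
  using add_left[of "u - v" v x] by simp

lemma orth_scale:
  assumes "ip u v = 0"
  shows "ip (scale a u) (scale b v) = 0"
proof -
  have "ip (scale b v) u = 0"
    using orth_sym[OF assms] by (simp add: scale_left_form)
  then show ?thesis
    by (simp add: scale_left_form orth_sym)
qed

lemma pythagoras:
  assumes "ip u v = 0"
  shows "ip (u + v) (u + v) = ip u u + ip v v"
  using assms orth_sym[OF assms] by (simp add: add_left add_right)

text \<open>
  The quotient is \<open>0\<close> by convention if \<open>ip v v = 0\<close>; the residual is orthogonal in that case too,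
  because definiteness then forces \<open>v = 0\<close>.
\<close>

lemma residual_orth: "ip (u - scale (ip u v / ip v v) v) v = 0"
proof (cases "ip v v = 0")
  case True
  then show ?thesis
    using definite zero_right by metis
next
  case False
  then show ?thesis
    by (simp add: diff_left scale_left_form)
qed

text \<open>
  Orthogonality of each term to the sum of the later ones is weaker than pairwise orthogonality,
  and still lets the terms be split off from the front one at a time.
\<close>

lemma pythagoras_tails:
  fixes m n :: nat
  assumes "\<And>k. k < n \<Longrightarrow> ip (e k) (\<Sum>i=k+1..n. e i) = 0"
    and "m \<le> n"
  shows "ip (\<Sum>i=m..n. e i) (\<Sum>i=m..n. e i) = (\<Sum>i=m..n. ip (e i) (e i))"
  using assms(2)
proof (induction m rule: inc_induct)
  case base
  show ?case by simp
next
  case (step m)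
  have split: "(\<Sum>i=m..n. f i) = f m + (\<Sum>i=Suc m..n. f i)" for f :: "nat \<Rightarrow> 'w::ab_group_add"
    using step.hyps by (simp add: sum.atLeast_Suc_atMost)
  have "ip (e m) (\<Sum>i=Suc m..n. e i) = 0"
    using assms(1)[of m] step.hyps by simp
  then show ?case
    using step.IH by (simp add: split pythagoras)
qed

context
  fixes y :: "nat \<Rightarrow> 'v" and n :: nat
begin

abbreviation "c \<equiv> c_vec scale ip y n"
abbreviation "g \<equiv> gamma scale ip y n"
abbreviation "d \<equiv> d_vec scale ip y n"

lemma c_orth_tail:
  assumes "k < n"
  shows "ip (c k) (\<Sum>i=k+1..n. c i) = 0"
  unfolding c_vec_step[OF assms] alpha_def by (rule residual_orth)

lemma z2_orth_z1: "ip (z2 scale ip y n) (z1 scale ip y n) = 0"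
  unfolding z2_def gamma_def by (rule residual_orth)

text \<open>
  Shifting the summation index in \<open>p1\<close> turns it into the sum of \<open>beta (i - 1) c i\<close> over all of
  \<open>1 \<le> i \<le> n\<close>, since \<open>beta 0\<close> is an empty sum.  This is the double sum of \<open>alpha k c i\<close> over
  \<open>k < i\<close>, whose other order of summation collects the tails subtracted in the recursion.
\<close>

lemma sum_y_eq:
  assumes "n \<ge> 1"
  shows "(\<Sum>k=1..n. y k) = z1 scale ip y n + p1 scale ip y n"
proof -
  let ?a = "alpha scale ip y n"
  have "p1 scale ip y n = (\<Sum>i=1..n-1. \<Sum>k=1..i. scale (?a k) (c (i + 1)))"
    by (simp add: p1_def beta_def scale_sum_left)
  also have "\<dots> = (\<Sum>k=1..n-1. \<Sum>i=k..n-1. scale (?a k) (c (i + 1)))"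
    by (simp add: sum.Sigma) (rule sum.reindex_bij_witness[where i = prod.swap and j = prod.swap]; auto)
  also have "\<dots> = (\<Sum>k=1..n-1. scale (?a k) (\<Sum>i=k+1..n. c i))"
  proof (rule sum.cong)
    fix k
    have "(\<Sum>i=k+1..n. c i) = (\<Sum>i=k..n-1. c (i + 1))"
      using assms sum.shift_bounds_cl_nat_ivl[of c k 1 "n - 1"] by simp
    then show "(\<Sum>i=k..n-1. scale (?a k) (c (i + 1))) = scale (?a k) (\<Sum>i=k+1..n. c i)"
      by (simp add: scale_sum_right)
  qed simp
  also have "\<dots> = (\<Sum>k=1..n-1. y k - c k)"
    by (rule sum.cong) (auto simp: c_vec_step)
  finally have p: "p1 scale ip y n = (\<Sum>k=1..n-1. y k) - (\<Sum>k=1..n-1. c k)"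
    by (simp add: sum_subtractf)
  have last: "(\<Sum>k=1..n. f k) = (\<Sum>k=1..n-1. f k) + f n" for f :: "nat \<Rightarrow> 'v"
    using assms by (cases n) auto
  show ?thesis
    unfolding z1_def p last[of y] last[of c] by (simp add: c_vec_last)
qed

lemma sum_d_initial: "(\<Sum>i=1..n. d i) = scale (1 + g) (z1 scale ip y n)"
  by (simp add: d_vec_def z1_def scale_sum_right)

lemma sum_d_eq: "(\<Sum>i=1..n+1. d i) = scale (1 + g) (z1 scale ip y n) + z2 scale ip y n"
  using sum_d_initial by (simp add: d_vec_def)

lemma sum_y_eq_sum_d:
  assumes "n \<ge> 1"
  shows "(\<Sum>i=1..n. y i) = (\<Sum>i=1..n+1. d i)"
  unfolding sum_d_eq sum_y_eq[OF assms] z2_def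
  by (simp add: scale_left_distrib)

lemma form_sum_d:
  assumes "n \<ge> 1"
  shows "ip (\<Sum>i=1..n+1. d i) (\<Sum>i=1..n+1. d i) = (\<Sum>i=1..n+1. ip (d i) (d i))"
proof -
  let ?s = "\<Sum>i=1..n. d i"
  have "ip (d k) (\<Sum>i=k+1..n. d i) = 0" if "k < n" for k
  proof -
    have "(\<Sum>i=k+1..n. d i) = scale (1 + g) (\<Sum>i=k+1..n. c i)"
      by (simp add: d_vec_def scale_sum_right)
    then show ?thesis
      using orth_scale[OF c_orth_tail[OF that]] that by (simp add: d_vec_def)
  qed
  then have initial: "ip ?s ?s = (\<Sum>i=1..n. ip (d i) (d i))"
    using assms by (rule pythagoras_tails)
  have "ip ?s (d (n + 1)) = 0"
    using orth_scale[OF orth_sym[OF z2_orth_z1], of "1 + g" 1]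
    unfolding sum_d_initial by (simp add: d_vec_def)
  then have "ip (?s + d (n + 1)) (?s + d (n + 1)) = ip ?s ?s + ip (d (n + 1)) (d (n + 1))"
    by (rule pythagoras)
  then show ?thesis
    using initial by simp
qed

end

end

lemma real_inner_form: "orthogonality_form scaleR (inner :: 'a::real_inner \<Rightarrow> 'a \<Rightarrow> real)"
  by unfold_locales (auto simp: inner_add_left inner_add_right inner_commute)

context complex_inner_space
begin

lemma orthogonality_form: "orthogonality_form scale cip"
proof
  fix u v x :: 'v and a :: complex
  show "cip (u + v) x = cip u x + cip v x" by (rule cip_add_left)
  show "cip x (u + v) = cip x u + cip x v"
    by (metis cip_add_left cip_commute complex_cnj_add)
  show "cip (scale a u) v = a * cip u v" by (rule cip_scale_left)
  show "cip v u = 0" if "cip u v = 0"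
    using that cip_commute[of v u] by simp
  show "u = 0" if "cip u u = 0"
    using that by (rule cip_self_eq_0)
qed

lemma ip_norm_power2: "(ip_norm cip v)\<^sup>2 = Re (cip v v)"
  by (simp add: ip_norm_def cip_self_nonneg)

end

theorem mainTheorem2:
  fixes n :: nat
    and y :: "nat \<Rightarrow> 'a::real_inner"
    and scaleC :: "complex \<Rightarrow> 'b::ab_group_add \<Rightarrow> 'b"
    and cip :: "'b \<Rightarrow> 'b \<Rightarrow> complex"
    and w :: "nat \<Rightarrow> 'b"
  assumes "n \<ge> 1"
  shows
    "(lin_indep_family (scaleR :: real \<Rightarrow> 'a \<Rightarrow> 'a) y n \<longrightarrow>
       (let d = d_vec scaleR inner y n in
         (\<Sum>i=1..n. y i) = (\<Sum>i=1..n+1. d i) \<and>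
         (norm (\<Sum>i=1..n. y i))\<^sup>2 = (norm (\<Sum>i=1..n+1. d i))\<^sup>2 \<and>
         (norm (\<Sum>i=1..n+1. d i))\<^sup>2 = (\<Sum>i=1..n+1. (norm (d i))\<^sup>2)))
     \<and>
     (complex_inner_space scaleC cip \<and> lin_indep_family scaleC w n \<longrightarrow>
       (let d = d_vec scaleC cip w n in
         (\<Sum>i=1..n. w i) = (\<Sum>i=1..n+1. d i) \<and>
         (ip_norm cip (\<Sum>i=1..n. w i))\<^sup>2 = (ip_norm cip (\<Sum>i=1..n+1. d i))\<^sup>2 \<and>
         (ip_norm cip (\<Sum>i=1..n+1. d i))\<^sup>2 = (\<Sum>i=1..n+1. (ip_norm cip (d i))\<^sup>2)))"
proof (intro conjI impI)
  interpret R: orthogonality_form "scaleR :: real \<Rightarrow> 'a \<Rightarrow> 'a" inner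
    by (rule real_inner_form)
  show "let d = d_vec scaleR inner y n in
         (\<Sum>i=1..n. y i) = (\<Sum>i=1..n+1. d i) \<and>
         (norm (\<Sum>i=1..n. y i))\<^sup>2 = (norm (\<Sum>i=1..n+1. d i))\<^sup>2 \<and>
         (norm (\<Sum>i=1..n+1. d i))\<^sup>2 = (\<Sum>i=1..n+1. (norm (d i))\<^sup>2)"
    unfolding Let_def R.sum_y_eq_sum_d[OF assms] power2_norm_eq_inner
    using R.form_sum_d[OF assms] by blast
next
  assume "complex_inner_space scaleC cip \<and> lin_indep_family scaleC w n"
  then interpret C: complex_inner_space scaleC cip by simp
  interpret F: orthogonality_form scaleC cip
    by (rule C.orthogonality_form)
  show "let d = d_vec scaleC cip w n in
         (\<Sum>i=1..n. w i) = (\<Sum>i=1..n+1. d i) \<and>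
         (ip_norm cip (\<Sum>i=1..n. w i))\<^sup>2 = (ip_norm cip (\<Sum>i=1..n+1. d i))\<^sup>2 \<and>
         (ip_norm cip (\<Sum>i=1..n+1. d i))\<^sup>2 = (\<Sum>i=1..n+1. (ip_norm cip (d i))\<^sup>2)"
    unfolding Let_def F.sum_y_eq_sum_d[OF assms] C.ip_norm_power2 F.form_sum_d[OF assms] Re_sum
    by blast
qed

end
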